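(* Suppose that $\lambda_1\ge\dots\ge\lambda_{\tilde d}$, $\lambda_d>0$ and $\lambda_d>\lambda_{d+1}$. Let $n\in\{1,\dots,\ell\}$ and define the matrices $B,C,D\in\mathbb{R}^{(\tilde d-d)\times(\tilde d-d)}$, with rows and columns indexed by $\{d+1,\dots,\tilde d\}$, as $$B=\mathrm{diag}(b_{d+1},\dots,b_{\tilde d}),\qquad C_{ij}=\xi_{n-1}^j(\lambda_i),\qquad D=\mathrm{diag}\bigg(\frac{\|\xi_{n-1}^{d+1}\|^2}{\xi_{n-1}^{d+1}(\lambda_{d+1})},\dots,\frac{\|\xi_{n-1}^{\tilde d}\|^2}{\xi_{n-1}^{\tilde d}(\lambda_{\tilde d})}\bigg).$$ Also define $w=(\varsigma_n(\lambda_{d+1}),\dots,\varsigma_n(\lambda_{\tilde d}))^\top$. With $\sigma=(D+B^2C)^{-1}B^2w$, we have $$\tilde\pi_n=\pi_n-\pi_n(0)\sum_{j=d+1}^{\tilde d}\sigma_j\,\xi_{n-1}^j.$$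
   Context: Let $\tilde d\ge d$ be positive integers, $\lambda_1,\dots,\lambda_{\tilde d}\in\mathbb{R}$ and $b_1,\dots,b_{\tilde d}\in\mathbb{R}$. Let $A=\mathrm{diag}(\lambda_1,\dots,\lambda_d)$ and $b=(b_1,\dots,b_d)^\top$. The grade $\ell$ of $(A,b)$ is the largest integer $n$ such that $\mathrm{span}\{b,Ab,\dots,A^{n-1}b\}$ has dimension $n$. $\mathcal{P}_{\le n}$ is the space of real univariate polynomials of degree at most $n$. On polynomials define the semi-inner products $$\langle p,q\rangle=\sum_{i=1}^d b_i^2p(\lambda_i)q(\lambda_i),\qquad\langle p,q\rangle_\sim=\sum_{i=1}^{\tilde d}b_i^2p(\lambda_i)q(\lambda_i),$$ with induced semi-norms $\|\cdot\|$ and $\|\cdot\|_\sim$. For $n\le\ell$, $\pi_n$ (resp. $\tilde\pi_n$) is the unique minimizer of $\|\pi\|^2$ (resp. $\|\pi\|_\sim^2$) over $\pi\in\mathcal{P}_{\le n}$ whose coefficient of degree $n$ equals $1$. For $d<j\le\tilde d$ and $0\le n<\ell$, $\zeta_n^j$ is the unique minimizer of $\|\zeta\|^2$ over $\zeta\in\mathcal{P}_{\le n}$ subject to $\zeta(\lambda_j)=1$. Under the stated assumptions on the $\lambda_i$, all roots of $\pi_n$ ($n\le\ell$) and of $\zeta_n^j$ ($n<\ell$) are real and positive, so one can define $\varsigma_n=\pi_n/\pi_n(0)$ and $\xi_n^j=\zeta_n^j/\zeta_n^j(0)$. *)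

theory Defs
  imports
    "Jordan_Normal_Form.Gauss_Jordan_Elimination"
    "Jordan_Normal_Form.DL_Rank"
begin

text \<open>
  The data \<open>\<lambda>\<^sub>1, \<lambda>\<^sub>2, \<dots>\<close> and \<open>b\<^sub>1, b\<^sub>2, \<dots>\<close> are functions on \<open>nat\<close> that are only
  consulted at indices \<open>1, 2, \<dots>\<close>, whereas entries of vectors and matrices are indexed from \<open>0\<close>.
\<close>

definition A_mat :: "(nat \<Rightarrow> real) \<Rightarrow> nat \<Rightarrow> real mat" where
  "A_mat lam d = mat_diag d (\<lambda>i. lam (i + 1))"

definition b_vec :: "(nat \<Rightarrow> real) \<Rightarrow> nat \<Rightarrow> real vec" where
  "b_vec b d = vec d (\<lambda>i. b (i + 1))"

text \<open>
  The set below always contains \<open>0\<close> and is bounded by the dimension of the ambient space, so that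
  \<open>GREATEST\<close> really picks its maximum.
\<close>

definition (in vec_space) grade :: "'a mat \<Rightarrow> 'a vec \<Rightarrow> nat" where
  "grade A v =
    (GREATEST k. vectorspace.dim class_ring (span_vs {(A ^\<^sub>m i) *\<^sub>v v | i. i < k}) = k)"

text \<open>
  Everything below takes the number \<open>N\<close> of nodes as a parameter: \<open>N = d\<close> gives the plain objects,
  \<open>N = d'\<close> with \<open>d' \<ge> d\<close> those with a tilde.
\<close>

definition semi_inner ::
    "(nat \<Rightarrow> real) \<Rightarrow> (nat \<Rightarrow> real) \<Rightarrow> nat \<Rightarrow> real poly \<Rightarrow> real poly \<Rightarrow> real" where
  "semi_inner lam b N p q = (\<Sum>i = 1..N. (b i)\<^sup>2 * poly p (lam i) * poly q (lam i))"

definition semi_norm :: "(nat \<Rightarrow> real) \<Rightarrow> (nat \<Rightarrow> real) \<Rightarrow> nat \<Rightarrow> real poly \<Rightarrow> real" where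
  "semi_norm lam b N p = sqrt (semi_inner lam b N p p)"

definition pi_poly :: "(nat \<Rightarrow> real) \<Rightarrow> (nat \<Rightarrow> real) \<Rightarrow> nat \<Rightarrow> nat \<Rightarrow> real poly" where
  "pi_poly lam b N n =
    (THE p. is_arg_min (\<lambda>q. (semi_norm lam b N q)\<^sup>2) (\<lambda>q. degree q \<le> n \<and> coeff q n = 1) p)"

definition zeta_poly ::
    "(nat \<Rightarrow> real) \<Rightarrow> (nat \<Rightarrow> real) \<Rightarrow> nat \<Rightarrow> nat \<Rightarrow> nat \<Rightarrow> real poly" where
  "zeta_poly lam b N n j =
    (THE p. is_arg_min (\<lambda>q. (semi_norm lam b N q)\<^sup>2) (\<lambda>q. degree q \<le> n \<and> poly q (lam j) = 1) p)"

definition varsigma_poly :: "(nat \<Rightarrow> real) \<Rightarrow> (nat \<Rightarrow> real) \<Rightarrow> nat \<Rightarrow> nat \<Rightarrow> real poly" where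
  "varsigma_poly lam b N n = Polynomial.smult (1 / poly (pi_poly lam b N n) 0) (pi_poly lam b N n)"

definition xi_poly ::
    "(nat \<Rightarrow> real) \<Rightarrow> (nat \<Rightarrow> real) \<Rightarrow> nat \<Rightarrow> nat \<Rightarrow> nat \<Rightarrow> real poly" where
  "xi_poly lam b N n j = Polynomial.smult (1 / poly (zeta_poly lam b N n j) 0) (zeta_poly lam b N n j)"

end

theory Submission
  imports Defs
begin

text \<open>
  On polynomials of degree less than \<open>n \<le> \<ell>\<close> the form \<open>\<langle>\<cdot>,\<cdot>\<rangle>\<close> is definite, so evaluation at
  \<open>\<lambda>\<^sub>j\<close> is represented by a polynomial \<open>R\<^sub>j\<close>. The minimizer \<open>\<zeta>\<^sub>n\<^sub>-\<^sub>1\<^sup>j\<close> is a multiple of \<open>R\<^sub>j\<close>,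
  whence \<open>\<xi>\<^sub>n\<^sub>-\<^sub>1\<^sup>j = R\<^sub>j / R\<^sub>j(0)\<close> and \<open>D\<^sub>j\<^sub>j = 1 / R\<^sub>j(0)\<close>. With the Gram matrix
  \<open>K\<^sub>i\<^sub>j = R\<^sub>j(\<lambda>\<^sub>i)\<close> this gives \<open>D + B\<^sup>2 C = (I + B\<^sup>2 K) diag(1 / R\<^sub>j(0))\<close>, which is invertible
  because \<open>K\<close> is positive semidefinite. Finally \<open>\<pi>\<^sub>n\<close> with a tilde is characterized by being
  monic of degree \<open>n\<close> and orthogonal to all polynomials of lower degree; for the candidate,
  the reproducing property turns this into the linear system that defines \<open>\<sigma>\<close>.
\<close>

text \<open>Stated through coefficients because \<open>degree p < n\<close> would exclude the zero
  polynomial at \<open>n = 0\<close>; here \<open>n = 0\<close> describes the zero space, as the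
  induction below requires.\<close>

abbreviation deg_below :: "nat \<Rightarrow> real poly \<Rightarrow> bool" where
  "deg_below n p \<equiv> \<forall>i\<ge>n. coeff p i = 0"

definition definite_below :: "(nat \<Rightarrow> real) \<Rightarrow> (nat \<Rightarrow> real) \<Rightarrow> nat \<Rightarrow> nat \<Rightarrow> bool" where
  "definite_below lam b N n \<longleftrightarrow>
    (\<forall>p. deg_below n p \<longrightarrow> semi_inner lam b N p p = 0 \<longrightarrow> p = 0)"

section \<open>Bilinearity, positivity and null polynomials of the form\<close>

lemma semi_inner_commute: "semi_inner lam b N p q = semi_inner lam b N q p"
  by (simp add: semi_inner_def mult.commute mult.left_commute)

lemma semi_inner_add_left:
  "semi_inner lam b N (p + q) r = semi_inner lam b N p r + semi_inner lam b N q r"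
  by (simp add: semi_inner_def algebra_simps sum.distrib)

lemma semi_inner_diff_left:
  "semi_inner lam b N (p - q) r = semi_inner lam b N p r - semi_inner lam b N q r"
  by (simp add: semi_inner_def algebra_simps sum_subtractf)

lemma semi_inner_smult_left:
  "semi_inner lam b N (Polynomial.smult c p) r = c * semi_inner lam b N p r"
  by (simp add: semi_inner_def sum_distrib_left ac_simps)

lemma semi_inner_add_right:
  "semi_inner lam b N r (p + q) = semi_inner lam b N r p + semi_inner lam b N r q"
  using semi_inner_add_left semi_inner_commute by metis

lemma semi_inner_smult_right:
  "semi_inner lam b N r (Polynomial.smult c p) = c * semi_inner lam b N r p"
  using semi_inner_smult_left semi_inner_commute by metis

lemma semi_inner_zero_left: "semi_inner lam b N 0 r = 0"
  by (simp add: semi_inner_def)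

lemma semi_inner_sum_left:
  "semi_inner lam b N (\<Sum>j\<in>J. f j) r = (\<Sum>j\<in>J. semi_inner lam b N (f j) r)"
  by (induction J rule: infinite_finite_induct)
     (simp_all add: semi_inner_zero_left semi_inner_add_left)

lemma semi_inner_nonneg: "semi_inner lam b N p p \<ge> 0"
  by (auto simp: semi_inner_def mult.assoc intro!: sum_nonneg)

lemma semi_norm_square: "(semi_norm lam b N p)\<^sup>2 = semi_inner lam b N p p"
  by (simp add: semi_norm_def semi_inner_nonneg)

lemma semi_inner_eq_0_imp:
  assumes "semi_inner lam b N p p = 0" and "i \<in> {1..N}"
  shows "b i * poly p (lam i) = 0"
proof -
  have "(\<Sum>i = 1..N. (b i * poly p (lam i))\<^sup>2) = 0"
    using assms(1) by (simp add: semi_inner_def power2_eq_square ac_simps)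
  then have "(b i * poly p (lam i))\<^sup>2 = 0"
    using assms(2) by (subst (asm) sum_nonneg_eq_0_iff) auto
  then show ?thesis by simp
qed

text \<open>All summands are nonnegative, so each vanishes, and a positive weight can be cancelled
  from it. This turns orthogonality to a multiple of a hypothetical factor into a contradiction with
  definiteness.\<close>

lemma semi_inner_weighted_eq_0_imp:
  assumes "(\<Sum>i = 1..N. c i * ((b i)\<^sup>2 * poly p (lam i) * poly p (lam i))) = 0"
    and "\<And>i. i \<in> {1..N} \<Longrightarrow> c i > 0"
  shows "semi_inner lam b N p p = 0"
proof -
  have "c i * ((b i)\<^sup>2 * poly p (lam i) * poly p (lam i)) = 0" if "i \<in> {1..N}" for i
  proof -
    have "\<forall>i\<in>{1..N}. c i * ((b i)\<^sup>2 * poly p (lam i) * poly p (lam i)) = 0"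
    proof (subst sum_nonneg_eq_0_iff[symmetric])
      show "0 \<le> c i * ((b i)\<^sup>2 * poly p (lam i) * poly p (lam i))" if "i \<in> {1..N}" for i
        using assms(2)[OF that] by (simp add: mult.assoc)
    qed (use assms(1) in auto)
    then show ?thesis using that by blast
  qed
  then have "(b i)\<^sup>2 * poly p (lam i) * poly p (lam i) = 0" if "i \<in> {1..N}" for i
    using assms(2) that by fastforce
  then show ?thesis unfolding semi_inner_def by (intro sum.neutral) blast
qed

lemma semi_inner_mono:
  assumes "N \<le> N'"
  shows "semi_inner lam b N p p \<le> semi_inner lam b N' p p"
  unfolding semi_inner_def
  by (rule sum_mono2) (use assms in \<open>auto simp: mult.assoc\<close>)

text \<open>More nodes enlarge the form and a lower degree shrinks the space. This carries
  definiteness from \<open>d\<close> nodes to \<open>d'\<close> nodes.\<close>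

lemma definite_below_mono:
  assumes "definite_below lam b N n" and "N \<le> N'" and "n' \<le> n"
  shows "definite_below lam b N' n'"
  unfolding definite_below_def
proof (intro allI impI)
  fix p assume p: "deg_below n' p" "semi_inner lam b N' p p = 0"
  have "semi_inner lam b N p p = 0"
    using semi_inner_mono[OF assms(2), of lam b p] semi_inner_nonneg[of lam b N p] p(2) by simp
  then show "p = 0" using assms(1,3) p(1) by (auto simp: definite_below_def)
qed

text \<open>A Gram-Schmidt step in each degree: the induction hypothesis is applied to
  \<open>L\<close> itself and to the functional given by the monomial of degree \<open>n\<close>.
  The second representer is the projection of that monomial to lower degrees.\<close>

lemma semi_inner_riesz:
  fixes L :: "real poly \<Rightarrow> real"
  assumes "definite_below lam b N n"
    and "\<And>p q. L (p + q) = L p + L q"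
    and "\<And>c p. L (Polynomial.smult c p) = c * L p"
  shows "\<exists>r. deg_below n r \<and> (\<forall>q. deg_below n q \<longrightarrow> semi_inner lam b N r q = L q)"
  using assms
proof (induction n arbitrary: L)
  case 0
  have "L 0 = 0" using 0(3)[of 0 0] by simp
  then have "L q = 0" if "deg_below 0 q" for q
    using that by (metis leading_coeff_0_iff zero_le)
  then show ?case by (intro exI[of _ 0]) (simp add: semi_inner_zero_left)
next
  case (Suc n)
  have def_n: "definite_below lam b N n"
    using definite_below_mono[OF Suc.prems(1)] by simp
  obtain r0 where r0: "deg_below n r0"
    "\<And>q. deg_below n q \<Longrightarrow> semi_inner lam b N r0 q = L q"
    using Suc.IH[OF def_n Suc.prems(2,3)] by blast
  obtain r1 where r1: "deg_below n r1"
    "\<And>q. deg_below n q \<Longrightarrow> semi_inner lam b N r1 q = semi_inner lam b N (monom 1 n) q"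
    using Suc.IH[OF def_n, of "semi_inner lam b N (monom 1 n)"]
      semi_inner_add_right semi_inner_smult_right by blast
  define e where "e = monom 1 n - r1"
  have e_orth: "semi_inner lam b N e q = 0" if "deg_below n q" for q
    using r1(2)[OF that] by (simp add: e_def semi_inner_diff_left)
  have e_n: "coeff e n = 1" and e_below: "deg_below (Suc n) e"
    using r1(1) by (auto simp: e_def)
  have "e \<noteq> 0" using e_n by auto
  then have ee: "semi_inner lam b N e e \<noteq> 0"
    using Suc.prems(1) e_below by (auto simp: definite_below_def)
  \<comment> \<open>Adding a multiple of \<open>e\<close> leaves the values on lower degrees intact;
    this multiple makes the value on \<open>e\<close> equal to \<open>L e\<close>.\<close>
  define t where "t = L e / semi_inner lam b N e e"
  let ?r = "r0 + Polynomial.smult t e"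
  have "semi_inner lam b N ?r q = L q" if q: "deg_below (Suc n) q" for q
  proof -
    define c q0 where "c = coeff q n" and "q0 = q - Polynomial.smult (coeff q n) e"
    have q_eq: "q = q0 + Polynomial.smult c e" by (simp add: q0_def c_def)
    have q0: "deg_below n q0"
      using q e_n e_below unfolding q0_def by (auto simp: le_eq_less_or_eq[of n] Suc_le_eq)
    show ?thesis
      using e_orth[OF r0(1)] e_orth[OF q0] r0(2)[OF q0] ee
      by (simp add: q_eq semi_inner_add_left semi_inner_add_right semi_inner_smult_left
          semi_inner_smult_right Suc.prems(2,3) t_def semi_inner_commute[of lam b N r0 e])
  qed
  moreover have "deg_below (Suc n) ?r" using r0(1) e_below by simp
  ultimately show ?case by blast
qed

section \<open>Minimizers characterized by orthogonality\<close>

lemma deg_below_diff_monic: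
  assumes "degree p \<le> n" "coeff p n = 1" "degree q \<le> n" "coeff q n = (1 :: real)"
  shows "deg_below n (p - q)"
  using assms by (auto simp: le_less coeff_eq_0)

lemma deg_below_Suc_iff: "deg_below (Suc m) p \<longleftrightarrow> degree p \<le> m"
  by (auto simp: coeff_eq_0 intro!: degree_le)

lemma semi_inner_pythagoras:
  assumes "semi_inner lam b N p (q - p) = 0"
  shows "semi_inner lam b N q q = semi_inner lam b N p p + semi_inner lam b N (q - p) (q - p)"
proof -
  have "semi_inner lam b N (p + (q - p)) (p + (q - p))
      = semi_inner lam b N p p + semi_inner lam b N (q - p) (q - p)"
    using assms by (simp only: semi_inner_add_left semi_inner_add_right
        semi_inner_commute[of lam b N "q - p" p] add_0_left add_0_right)
  then show ?thesis by simp
qed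

text \<open>Pythagoras gives minimality, and definiteness on differences gives uniqueness, so
  \<open>THE\<close> is resolved. Both \<open>pi_poly\<close> and \<open>zeta_poly\<close> are
  identified in this way.\<close>

lemma the_arg_min_semi_norm_eqI:
  assumes "definite_below lam b N n" and "P p"
    and below: "\<And>q. P q \<Longrightarrow> deg_below n (q - p)"
    and orth: "\<And>q. P q \<Longrightarrow> semi_inner lam b N p (q - p) = 0"
  shows "(THE p. is_arg_min (\<lambda>q. (semi_norm lam b N q)\<^sup>2) P p) = p"
proof (rule the_equality)
  have "semi_inner lam b N p p \<le> semi_inner lam b N q q" if "P q" for q
    using semi_inner_pythagoras[OF orth[OF that]] semi_inner_nonneg[of lam b N "q - p"] by linarith
  then show "is_arg_min (\<lambda>q. (semi_norm lam b N q)\<^sup>2) P p"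
    using \<open>P p\<close> by (simp add: is_arg_min_linorder semi_norm_square)
next
  fix q assume q: "is_arg_min (\<lambda>q. (semi_norm lam b N q)\<^sup>2) P q"
  then have "P q" and "semi_inner lam b N q q \<le> semi_inner lam b N p p"
    using \<open>P p\<close> by (auto simp: is_arg_min_linorder semi_norm_square)
  then have "semi_inner lam b N (q - p) (q - p) = 0"
    using semi_inner_pythagoras[OF orth[OF \<open>P q\<close>]] semi_inner_nonneg[of lam b N "q - p"] by linarith
  then have "q - p = 0"
    using assms(1) below[OF \<open>P q\<close>] unfolding definite_below_def by blast
  then show "q = p" by simp
qed

lemma pi_poly_eqI:
  assumes "definite_below lam b N n" and "degree p \<le> n" and "coeff p n = 1"
    and "\<And>q. deg_below n q \<Longrightarrow> semi_inner lam b N p q = 0"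
  shows "pi_poly lam b N n = p"
  unfolding pi_poly_def
  by (rule the_arg_min_semi_norm_eqI[OF assms(1)])
     (use assms deg_below_diff_monic in blast)+

lemma pi_poly_props:
  assumes "definite_below lam b N n"
  shows "degree (pi_poly lam b N n) \<le> n" and "coeff (pi_poly lam b N n) n = 1"
    and "deg_below n q \<Longrightarrow> semi_inner lam b N (pi_poly lam b N n) q = 0"
proof -
  obtain r where r: "deg_below n r"
    "\<And>q. deg_below n q \<Longrightarrow> semi_inner lam b N r q = semi_inner lam b N (monom 1 n) q"
    using semi_inner_riesz[OF assms, of "semi_inner lam b N (monom 1 n)"]
      semi_inner_add_right semi_inner_smult_right by blast
  let ?p = "monom 1 n - r"
  have p: "degree ?p \<le> n" "coeff ?p n = 1"
    using r(1) by (auto intro!: degree_le)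
  have orth: "semi_inner lam b N ?p q = 0" if "deg_below n q" for q
    using r(2)[OF that] by (simp add: semi_inner_diff_left)
  have "pi_poly lam b N n = ?p" by (rule pi_poly_eqI[OF assms p orth])
  then show "degree (pi_poly lam b N n) \<le> n" "coeff (pi_poly lam b N n) n = 1"
    "deg_below n q \<Longrightarrow> semi_inner lam b N (pi_poly lam b N n) q = 0"
    using p orth by auto
qed

text \<open>If the polynomial were X q, its orthogonality to q would make the sum of
  \<open>lam i\<close> times the squares of \<open>b i * poly q (lam i)\<close> vanish. Then q = 0,
  against monicity.\<close>

lemma pi_poly_0_neq_0:
  assumes "definite_below lam b N n" and "1 \<le> n" and "\<And>i. i \<in> {1..N} \<Longrightarrow> lam i > 0"
  shows "poly (pi_poly lam b N n) 0 \<noteq> 0"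
proof
  assume "poly (pi_poly lam b N n) 0 = 0"
  then obtain q where q: "pi_poly lam b N n = [:0, 1:] * q"
    using poly_eq_0_iff_dvd[of "pi_poly lam b N n" 0] by auto
  have coeff_q: "coeff q i = coeff (pi_poly lam b N n) (Suc i)" for i by (simp add: q)
  have q_below: "deg_below n q"
    using pi_poly_props(1)[OF assms(1)] by (auto simp: coeff_q intro!: coeff_eq_0)
  have "(\<Sum>i = 1..N. lam i * ((b i)\<^sup>2 * poly q (lam i) * poly q (lam i))) = 0"
    using pi_poly_props(3)[OF assms(1) q_below] by (simp add: q semi_inner_def ac_simps)
  then have "semi_inner lam b N q q = 0"
    using assms(3) by (intro semi_inner_weighted_eq_0_imp[where c = lam])
  then have "q = 0" using assms(1) q_below by (auto simp: definite_below_def)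
  then show False using pi_poly_props(2)[OF assms(1)] by (simp add: q)
qed

section \<open>Polynomials representing point evaluation\<close>

lemma reproducing_poly_exists:
  assumes "definite_below lam b N n"
  shows "\<exists>r. deg_below n r \<and> (\<forall>q. deg_below n q \<longrightarrow> semi_inner lam b N r q = poly q x)"
  using semi_inner_riesz[OF assms, of "\<lambda>q. poly q x"] by simp

text \<open>Testing \<open>r\<close> against itself shows that the value at \<open>x\<close> is the
  squared norm of \<open>r\<close>. Testing against the constant 1 shows that \<open>r\<close> is
  not zero.\<close>

lemma reproducing_poly_pos:
  assumes "definite_below lam b N n" and "1 \<le> n" and "deg_below n r"
    and "\<And>q. deg_below n q \<Longrightarrow> semi_inner lam b N r q = poly q x"
  shows "poly r x > 0"
proof -
  have "deg_below n 1" using assms(2) by auto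
  then have "r \<noteq> 0" using assms(4)[of 1] by (auto simp: semi_inner_zero_left)
  then show ?thesis
    using assms(1,3) assms(4)[OF assms(3)] semi_inner_nonneg[of lam b N r]
    by (auto simp: definite_below_def less_le)
qed

text \<open>
  A reproducing polynomial divisible by \<open>X\<close>, say \<open>X q\<close>, would be orthogonal to \<open>(X - x) q\<close>,
  which makes a sum of positive multiples of \<open>q(\<lambda>\<^sub>i)\<^sup>2\<close> vanish.
\<close>

lemma reproducing_poly_0_neq_0:
  assumes "definite_below lam b N n" and "1 \<le> n" and "deg_below n r"
    and "\<And>q. deg_below n q \<Longrightarrow> semi_inner lam b N r q = poly q x"
    and "\<And>i. i \<in> {1..N} \<Longrightarrow> lam i > 0" and "\<And>i. i \<in> {1..N} \<Longrightarrow> lam i > x"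
  shows "poly r 0 \<noteq> 0"
proof
  assume "poly r 0 = 0"
  then obtain q where q: "r = [:0, 1:] * q"
    using poly_eq_0_iff_dvd[of r 0] by auto
  have coeff_q: "coeff q i = coeff r (Suc i)" for i by (simp add: q)
  have q_below: "deg_below n q" using assms(3) by (auto simp: coeff_q)
  have "deg_below n ([:-x, 1:] * q)"
    using assms(3) q_below unfolding q by simp
  then have "semi_inner lam b N r ([:-x, 1:] * q) = 0"
    using assms(4) by simp
  then have "(\<Sum>i = 1..N. (lam i * (lam i - x)) * ((b i)\<^sup>2 * poly q (lam i) * poly q (lam i))) = 0"
    by (simp add: q semi_inner_def algebra_simps)
  then have "semi_inner lam b N q q = 0"
    using assms(5,6) by (intro semi_inner_weighted_eq_0_imp[where c = "\<lambda>i. lam i * (lam i - x)"]) simp_all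
  then have "q = 0" using assms(1) q_below by (auto simp: definite_below_def)
  then show False using reproducing_poly_pos[OF assms(1-4)] by (simp add: q)
qed

text \<open>Two competitors with value 1 at \<open>lam j\<close> differ by a polynomial vanishing
  there, and \<open>r\<close> is orthogonal to it. Hence \<open>r\<close> divided by its value at
  \<open>lam j\<close> is the minimizer, and the normalization at 0 cancels that constant.\<close>

lemma xi_poly_eq:
  assumes "definite_below lam b N (Suc m)" and "deg_below (Suc m) r"
    and "\<And>q. deg_below (Suc m) q \<Longrightarrow> semi_inner lam b N r q = poly q (lam j)"
  shows "xi_poly lam b N m j = Polynomial.smult (1 / poly r 0) r"
proof -
  have pos: "poly r (lam j) > 0" by (rule reproducing_poly_pos[OF assms(1) _ assms(2,3)]) simp_all
  have "zeta_poly lam b N m j = Polynomial.smult (1 / poly r (lam j)) r"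
    unfolding zeta_poly_def
  proof (rule the_arg_min_semi_norm_eqI[OF assms(1)])
    let ?p = "Polynomial.smult (1 / poly r (lam j)) r"
    show p: "degree ?p \<le> m \<and> poly ?p (lam j) = 1"
      using pos assms(2) deg_below_Suc_iff[of m r] by simp
    fix q assume q: "degree q \<le> m \<and> poly q (lam j) = 1"
    show below: "deg_below (Suc m) (q - ?p)"
      unfolding deg_below_Suc_iff using p q degree_diff_le by blast
    show "semi_inner lam b N ?p (q - ?p) = 0"
      unfolding semi_inner_smult_left[of lam b N _ r] assms(3)[OF below] using p q by simp
  qed
  then show ?thesis using pos by (simp add: xi_poly_def)
qed

section \<open>Krylov matrices: from the grade to definiteness\<close>

lemma mat_diag_pow: "mat_diag n f ^\<^sub>m k = mat_diag n (\<lambda>i. f i ^ k)"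
proof (induction k)
  case 0
  then show ?case by (auto simp: mat_diag_def)
next
  case (Suc k)
  then show ?case by (simp add: power_Suc2 del: power_Suc)
qed

text \<open>The rank concerns the set of columns, in which repetitions are lost. Full rank forces
  this set to have \<open>nc\<close> elements, so the columns are distinct, and a nonzero kernel
  vector would be a genuine dependence.\<close>

lemma (in vec_space) full_rank_kernel_trivial:
  assumes A: "A \<in> carrier_mat n nc" and "rank A = nc"
    and v: "v \<in> carrier_vec nc" "A *\<^sub>v v = 0\<^sub>v n"
  shows "v = 0\<^sub>v nc"
proof (rule ccontr)
  assume "v \<noteq> 0\<^sub>v nc"
  obtain S where S: "maximal S (\<lambda>T. T \<subseteq> set (cols A) \<and> lin_indpt T)"
    using maximal_exists_superset[of "set (cols A)" "\<lambda>T. T \<subseteq> set (cols A) \<and> lin_indpt T" "{}"]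
      finite_lin_indpt2[of "{}"] by auto
  then have "card S \<le> card (set (cols A))" by (auto simp: maximal_def intro: card_mono)
  then have "length (cols A) \<le> card (set (cols A))"
    using rank_card_indpt[OF A S] assms(2) A by simp
  then have "distinct (cols A)"
    by (meson card_distinct card_length le_antisym)
  then show False
    using full_rank_lin_indpt[OF A assms(2)] lin_depI[OF A v(1) \<open>v \<noteq> 0\<^sub>v nc\<close> v(2)] by blast
qed

lemma (in vec_space) rank_le_nr:
  assumes A: "A \<in> carrier_mat n nc"
  shows "rank A \<le> n"
proof -
  obtain S where S: "maximal S (\<lambda>T. T \<subseteq> set (cols A) \<and> lin_indpt T)"
    using maximal_exists_superset[of "set (cols A)" "\<lambda>T. T \<subseteq> set (cols A) \<and> lin_indpt T" "{}"]
      finite_lin_indpt2[of "{}"] by auto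
  then have "S \<subseteq> set (cols A)" "lin_indpt S" by (simp_all add: maximal_def)
  then have "S \<subseteq> carrier_vec n" "lin_indpt S" using cols_dim[of A] A by auto
  then have "card S \<le> n"
    using li_le_dim(2)[OF fin_dim, of S] dim_is_n by simp
  then show ?thesis using rank_card_indpt[OF A S] by simp
qed

lemma deg_below_poly_eq: "deg_below n p \<Longrightarrow> poly p x = (\<Sum>i<n. coeff p i * x ^ i)"
proof -
  assume p: "deg_below n p"
  have "(\<Sum>i<n. coeff p i * x ^ i) = (\<Sum>i\<in>{..<n} \<union> {..degree p}. coeff p i * x ^ i)"
    by (rule sum.mono_neutral_left) (use p in auto)
  also have "\<dots> = (\<Sum>i\<le>degree p. coeff p i * x ^ i)"
    by (rule sum.mono_neutral_right) (auto intro: coeff_eq_0)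
  finally show ?thesis by (simp add: poly_altdef)
qed

text \<open>A null polynomial satisfies \<open>b j * poly p (lam j) = 0\<close> at every node, which
  says that its coefficient vector lies in the kernel of the Krylov matrix. With as many columns as
  the grade, that matrix has full column rank.\<close>

lemma definite_below_grade:
  "definite_below lam b d (vec_space.grade d (A_mat lam d) (b_vec b d))"
proof -
  interpret vec_space "TYPE(real)" d .
  let ?A = "A_mat lam d" and ?v = "b_vec b d"
  define l where "l = grade ?A ?v"
  \<comment> \<open>Row-scaled Vandermonde matrix whose columns are the Krylov vectors.\<close>
  define K where "K = (\<lambda>k. mat d k (\<lambda>(j, i). lam (j + 1) ^ i * b (j + 1)))"
  have K_carrier: "K k \<in> carrier_mat d k" for k by (simp add: K_def)
  have A_pow: "?A ^\<^sub>m i = mat_diag d (\<lambda>j. lam (j + 1) ^ i)" for i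
    by (simp add: A_mat_def mat_diag_pow)
  have col_K: "col (K k) i = (?A ^\<^sub>m i) *\<^sub>v ?v" if "i < k" for k i
    unfolding A_pow using that
    by (intro eq_vecI)
       (auto simp: K_def b_vec_def mat_diag_def scalar_prod_def
         if_distrib[of "\<lambda>x. x * _"] cong: if_cong)
  have "set (cols (K k)) = {(?A ^\<^sub>m i) *\<^sub>v ?v | i. i < k}" for k
    using col_K[of _ k] by (auto simp: cols_def K_def)
  then have grade_eq: "grade ?A ?v = (GREATEST k. rank (K k) = k)"
    by (simp add: grade_def rank_def)
  have "rank (K l) = l"
    unfolding l_def grade_eq
  \<comment> \<open>The greatest element exists since the empty matrix qualifies and ranks are
    bounded by \<open>d\<close>.\<close>
  proof (rule GreatestI_nat[where k = 0 and b = d])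
    show "rank (K 0) = 0" using rank_le_nc[OF K_carrier[of 0]] by simp
    show "k \<le> d" if "rank (K k) = k" for k using rank_le_nr[OF K_carrier[of k]] that by simp
  qed
  show ?thesis
    unfolding definite_below_def l_def[symmetric]
  proof (intro allI impI)
    fix p assume p: "deg_below l p" "semi_inner lam b d p p = 0"
    have "K l *\<^sub>v vec l (coeff p) = 0\<^sub>v d"
    proof (rule eq_vecI)
      fix j assume j: "j < dim_vec (0\<^sub>v d :: real vec)"
      then have "(K l *\<^sub>v vec l (coeff p)) $ j = b (j + 1) * poly p (lam (j + 1))"
        by (simp add: K_def scalar_prod_def deg_below_poly_eq[OF p(1)] sum_distrib_left
            lessThan_atLeast0 ac_simps)
      also have "\<dots> = 0" using semi_inner_eq_0_imp[OF p(2), of "j + 1"] j by simp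
      finally show "(K l *\<^sub>v vec l (coeff p)) $ j = 0\<^sub>v d $ j" using j by simp
    qed (simp add: K_def)
    then have "vec l (coeff p) = 0\<^sub>v l"
      using full_rank_kernel_trivial[OF K_carrier \<open>rank (K l) = l\<close>] by simp
    then have "coeff p i = 0" if "i < l" for i
      using that by (metis index_vec index_zero_vec(1))
    then show "p = 0" using p(1) by (metis leading_coeff_0_iff not_le)
  qed
qed

text \<open>A trivial kernel makes the determinant nonzero, so \<open>mat_inverse\<close> returns
  \<open>Some\<close> and \<open>the\<close> yields the true inverse.\<close>

lemma invertible_mat_of_kernel_trivial:
  fixes M :: "real mat"
  assumes M: "M \<in> carrier_mat k k"
    and "\<forall>x\<in>carrier_vec k. M *\<^sub>v x = 0\<^sub>v k \<longrightarrow> x = 0\<^sub>v k"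
  shows "invertible_mat M"
    and "v \<in> carrier_vec k \<Longrightarrow> M *\<^sub>v (the (mat_inverse M) *\<^sub>v v) = v"
    and "v \<in> carrier_vec k \<Longrightarrow> the (mat_inverse M) *\<^sub>v v \<in> carrier_vec k"
proof -
  have "det M \<noteq> 0" using det_0_iff_vec_prod_zero_field[OF M] assms(2) by blast
  then have "M \<in> Units (ring_mat TYPE(real) k ())"
    by (rule det_non_zero_imp_unit[OF M])
  then obtain M' where M': "mat_inverse M = Some M'"
    using mat_inverse(1)[OF M, of "()"] by (cases "mat_inverse M") auto
  have inv: "M * M' = 1\<^sub>m k" "M' * M = 1\<^sub>m k" "M' \<in> carrier_mat k k"
    using mat_inverse(2)[OF M M'] by auto
  show "invertible_mat M"
    using M inv by (auto simp: invertible_mat_def inverts_mat_def square_mat.simps)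
  show "M *\<^sub>v (the (mat_inverse M) *\<^sub>v v) = v" if "v \<in> carrier_vec k"
    using assoc_mult_mat_vec[OF M inv(3) that] M' inv(1) that by simp
  show "the (mat_inverse M) *\<^sub>v v \<in> carrier_vec k" if "v \<in> carrier_vec k"
    using M' inv(3) that by simp
qed

theorem lemma3p3:
  fixes d d' n :: nat
    and lam b :: "nat \<Rightarrow> real"
    and B C D :: "real mat"
    and w \<sigma> :: "real vec"
  assumes "1 \<le> d" and "d \<le> d'"
    and "\<And>i j. 1 \<le> i \<Longrightarrow> i \<le> j \<Longrightarrow> j \<le> d' \<Longrightarrow> lam j \<le> lam i"
    and "lam d > 0"
    and "d < d' \<Longrightarrow> lam d > lam (d + 1)"
    and "n \<in> {1..vec_space.grade d (A_mat lam d) (b_vec b d)}"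
    and "B = mat_diag (d' - d) (\<lambda>i. b (d + 1 + i))"
    and "C = mat (d' - d) (d' - d)
               (\<lambda>(i, j). poly (xi_poly lam b d (n - 1) (d + 1 + j)) (lam (d + 1 + i)))"
    and "D = mat_diag (d' - d)
               (\<lambda>j. (semi_norm lam b d (xi_poly lam b d (n - 1) (d + 1 + j)))\<^sup>2
                    / poly (xi_poly lam b d (n - 1) (d + 1 + j)) (lam (d + 1 + j)))"
    and "w = vec (d' - d) (\<lambda>i. poly (varsigma_poly lam b d n) (lam (d + 1 + i)))"
    and "\<sigma> = the (mat_inverse (D + B ^\<^sub>m 2 * C)) *\<^sub>v (B ^\<^sub>m 2 *\<^sub>v w)"
  shows "invertible_mat (D + B ^\<^sub>m 2 * C) \<and>
    pi_poly lam b d' n = pi_poly lam b d n -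
      Polynomial.smult (poly (pi_poly lam b d n) 0)
        (\<Sum>j = d + 1..d'. Polynomial.smult (\<sigma> $ (j - (d + 1))) (xi_poly lam b d (n - 1) j))"
proof -
  define k where "k = d' - d"
  define R where "R = (\<lambda>j. SOME r. deg_below n r \<and>
    (\<forall>q. deg_below n q \<longrightarrow> semi_inner lam b d r q = poly q (lam j)))"
  define \<rho> where "\<rho> = (\<lambda>j. poly (R (d + 1 + j)) 0)"
  \<comment> \<open>Later \<open>y j\<close> is an entry divided by \<open>\<rho> j\<close>, which
    absorbs the column scaling of \<open>M\<close>.\<close>
  define U where "U = (\<lambda>y. \<Sum>j<k. Polynomial.smult (y j) (R (d + 1 + j)))"
  define M where "M = D + B ^\<^sub>m 2 * C"
  let ?p = "pi_poly lam b d n"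
  have n: "1 \<le> n" "Suc (n - 1) = n" using assms(6) by auto
  have lam_pos: "lam i > 0" if "i \<in> {1..d}" for i
    using assms(3)[of i d] assms(2,4) that by force
  have lam_gt: "lam i > lam (d + 1 + j)" if "i \<in> {1..d}" and "j < k" for i j
  proof -
    have "lam (d + 1 + j) \<le> lam (d + 1)" using that by (intro assms(3)) (auto simp: k_def)
    also have "\<dots> < lam d" using assms(5) that by (auto simp: k_def)
    also have "\<dots> \<le> lam i" using that assms(2) by (intro assms(3)) auto
    finally show ?thesis .
  qed
  have def_d: "definite_below lam b d n"
    using definite_below_mono[OF definite_below_grade order_refl] assms(6) by simp
  have def_d': "definite_below lam b d' n"
    using definite_below_mono[OF def_d assms(2)] by simp
  have R: "deg_below n (R j)"
    "\<And>q. deg_below n q \<Longrightarrow> semi_inner lam b d (R j) q = poly q (lam j)" for j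
    using someI_ex[OF reproducing_poly_exists[OF def_d, of "lam j"]] unfolding R_def by blast+
  have \<rho>: "\<rho> j \<noteq> 0" if "j < k" for j
    unfolding \<rho>_def
    by (rule reproducing_poly_0_neq_0[OF def_d n(1) R])
       (use lam_pos lam_gt that in auto)
  have xi: "xi_poly lam b d (n - 1) j = Polynomial.smult (1 / poly (R j) 0) (R j)" for j
    by (rule xi_poly_eq) (unfold n(2), use def_d R in auto)
  have R_pos: "poly (R j) (lam j) > 0" for j by (rule reproducing_poly_pos[OF def_d n(1) R])
  have p0: "poly ?p 0 \<noteq> 0" using pi_poly_0_neq_0[OF def_d n(1)] lam_pos by blast

  \<comment> \<open>The matrix expressed by representers\<close>
  have D_entry: "(semi_norm lam b d (xi_poly lam b d (n - 1) (d + 1 + j)))\<^sup>2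
      / poly (xi_poly lam b d (n - 1) (d + 1 + j)) (lam (d + 1 + j)) = 1 / \<rho> j" if "j < k" for j
    \<comment> \<open>The squared norm of \<open>R j\<close> is its own value at
      \<open>lam j\<close>, so this value cancels in the quotient.\<close>
    using \<rho>[OF that] R_pos[of "d + 1 + j"] R(2)[OF R(1), of "d + 1 + j" "d + 1 + j"]
    unfolding xi by (simp add: semi_norm_square semi_inner_smult_left semi_inner_smult_right \<rho>_def)
  have D_eq: "D = mat_diag k (\<lambda>j. 1 / \<rho> j)"
    using D_entry unfolding assms(9) k_def[symmetric] by (auto simp: mat_diag_def)
  have C_eq: "C = mat k k (\<lambda>(i, j). poly (R (d + 1 + j)) (lam (d + 1 + i)) / \<rho> j)"
    unfolding assms(8) xi k_def by (simp add: \<rho>_def)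
  have B2: "B ^\<^sub>m 2 = mat_diag k (\<lambda>i. (b (d + 1 + i))\<^sup>2)"
    by (simp add: assms(7) mat_diag_pow k_def)
  have C: "C \<in> carrier_mat k k" and D: "D \<in> carrier_mat k k" and w: "w \<in> carrier_vec k"
    using assms(8,9,10) by (simp_all add: k_def)
  have M: "M \<in> carrier_mat k k"
    unfolding M_def B2 using D C by (intro add_carrier_mat mult_carrier_mat[OF mat_diag_dim])
  have M_entry: "M $$ (i, j) = (if i = j then 1 / \<rho> j else 0)
      + (b (d + 1 + i))\<^sup>2 * poly (R (d + 1 + j)) (lam (d + 1 + i)) / \<rho> j"
    if "i < k" "j < k" for i j
    using that mat_diag_mult_left[OF C, of "\<lambda>i. (b (d + 1 + i))\<^sup>2"]
    unfolding M_def B2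
    by (simp add: D_eq C_eq mat_diag_def)
  have M_mult: "(M *\<^sub>v x) $ i = x $ i / \<rho> i
      + (b (d + 1 + i))\<^sup>2 * poly (U (\<lambda>j. x $ j / \<rho> j)) (lam (d + 1 + i))"
    if x: "x \<in> carrier_vec k" and i: "i < k" for x i
  proof -
    have "(M *\<^sub>v x) $ i = (\<Sum>j<k. M $$ (i, j) * x $ j)"
      using M x i by (simp add: scalar_prod_def lessThan_atLeast0)
    also have "\<dots> = (\<Sum>j<k. (if i = j then x $ j / \<rho> j else 0)
        + (b (d + 1 + i))\<^sup>2 * (x $ j / \<rho> j * poly (R (d + 1 + j)) (lam (d + 1 + i))))"
      using i by (intro sum.cong) (auto simp: M_entry algebra_simps)
    also have "\<dots> = x $ i / \<rho> i
        + (b (d + 1 + i))\<^sup>2 * poly (U (\<lambda>j. x $ j / \<rho> j)) (lam (d + 1 + i))"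
      using i by (simp add: sum.distrib sum.delta U_def poly_sum sum_distrib_left)
    finally show ?thesis .
  qed
  have U_below: "deg_below n (U y)" for y
    using R(1) by (simp add: U_def coeff_sum)
  have U_inner: "semi_inner lam b d (U y) q = (\<Sum>j<k. y j * poly q (lam (d + 1 + j)))"
    if "deg_below n q" for y q
    using that by (simp add: U_def semi_inner_sum_left semi_inner_smult_left R(2))

  \<comment> \<open>Invertibility\<close>
  have kernel: "\<forall>x\<in>carrier_vec k. M *\<^sub>v x = 0\<^sub>v k \<longrightarrow> x = 0\<^sub>v k"
  proof (intro ballI impI)
    fix x assume x: "x \<in> carrier_vec k" "M *\<^sub>v x = 0\<^sub>v k"
    define y where "y = (\<lambda>j. x $ j / \<rho> j)"
    define u where "u = (\<lambda>j. poly (U y) (lam (d + 1 + j)))"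
    \<comment> \<open>The kernel equation reads y = - B^2 u. Pairing with u gives the squared norm
      of \<open>U y\<close> on one side and minus a sum of squares on the other, so B u = 0 and then
      y = 0.\<close>
    have y_eq: "y i = - ((b (d + 1 + i))\<^sup>2 * u i)" if "i < k" for i
      using M_mult[OF x(1) that] x(2) that by (simp add: y_def u_def)
    have "semi_inner lam b d (U y) (U y) = (\<Sum>j<k. y j * u j)"
      using U_inner[OF U_below] by (simp add: u_def)
    also have "\<dots> = - (\<Sum>j<k. (b (d + 1 + j) * u j)\<^sup>2)"
      by (simp add: y_eq sum_negf power2_eq_square ac_simps)
    finally have "(\<Sum>j<k. (b (d + 1 + j) * u j)\<^sup>2) \<le> 0"
      using semi_inner_nonneg[of lam b d "U y"] by simp
    then have "(\<Sum>j<k. (b (d + 1 + j) * u j)\<^sup>2) = 0"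
      by (intro antisym sum_nonneg) auto
    then have "b (d + 1 + j) * u j = 0" if "j < k" for j
      using that by (subst (asm) sum_nonneg_eq_0_iff) auto
    then have "y j = 0" if "j < k" for j
      using y_eq[OF that] that by (auto simp: power2_eq_square)
    then have "x $ j = 0" if "j < k" for j
      using \<rho>[OF that] that by (auto simp: y_def)
    then show "x = 0\<^sub>v k" using x(1) by (intro eq_vecI) auto
  qed
  note inv = invertible_mat_of_kernel_trivial[OF M kernel]
  have Bw: "B ^\<^sub>m 2 *\<^sub>v w \<in> carrier_vec k"
    unfolding B2 using w by (intro mult_mat_vec_carrier[OF mat_diag_dim])
  have \<sigma>: "\<sigma> \<in> carrier_vec k" "M *\<^sub>v \<sigma> = B ^\<^sub>m 2 *\<^sub>v w"
    using inv(2,3)[OF Bw] by (simp_all add: assms(11) M_def)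

  \<comment> \<open>Orthogonality of the candidate\<close>
  define y where "y = (\<lambda>j. \<sigma> $ j / \<rho> j)"
  let ?P = "?p - Polynomial.smult (poly ?p 0) (U y)"
  \<comment> \<open>Row \<open>i\<close> of the system for \<open>\<sigma>\<close>, multiplied by
    \<open>poly ?p 0\<close>.\<close>
  have P_node: "(b (d + 1 + i))\<^sup>2 * poly ?P (lam (d + 1 + i)) = poly ?p 0 * y i"
    if i: "i < k" for i
  proof -
    have "(B ^\<^sub>m 2 *\<^sub>v w) $ i = (b (d + 1 + i))\<^sup>2 * w $ i"
      using i w
      by (simp add: B2 mat_diag_def scalar_prod_def if_distrib[of "\<lambda>x. x * _"] sum.delta cong: if_cong)
    also have "w $ i = poly ?p (lam (d + 1 + i)) / poly ?p 0"
      using i by (simp add: assms(10) k_def[symmetric] varsigma_poly_def)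
    finally have "y i + (b (d + 1 + i))\<^sup>2 * poly (U y) (lam (d + 1 + i))
        = (b (d + 1 + i))\<^sup>2 * (poly ?p (lam (d + 1 + i)) / poly ?p 0)"
      using M_mult[OF \<sigma>(1) i] \<sigma>(2) by (simp add: y_def)
    then have "poly ?p 0 * (y i + (b (d + 1 + i))\<^sup>2 * poly (U y) (lam (d + 1 + i)))
        = (b (d + 1 + i))\<^sup>2 * poly ?p (lam (d + 1 + i))"
      using p0 by simp
    then show ?thesis by (simp add: algebra_simps)
  qed
  have "pi_poly lam b d' n = ?P"
  proof (rule pi_poly_eqI[OF def_d'])
    have "degree (U y) \<le> n" using U_below by (intro degree_le) auto
    then show "degree ?P \<le> n"
      using pi_poly_props(1)[OF def_d] by (intro degree_diff_le) (auto intro: order_trans[OF degree_smult_le])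
    show "coeff ?P n = 1" using pi_poly_props(2)[OF def_d] U_below by simp
  next
    fix q assume q: "deg_below n q"
    let ?f = "\<lambda>i. (b i)\<^sup>2 * poly ?P (lam i) * poly q (lam i)"
    \<comment> \<open>The first \<open>d\<close> nodes contribute only through \<open>U y\<close>,
      since \<open>?p\<close> is orthogonal to \<open>q\<close>; by \<open>P_node\<close> the added
      nodes contribute the opposite amount.\<close>
    have "{1..d'} = {1..d} \<union> {d + 1..d'}" using assms(2) by auto
    then have "semi_inner lam b d' ?P q = semi_inner lam b d ?P q + (\<Sum>i = d + 1..d'. ?f i)"
      unfolding semi_inner_def by (simp only:) (rule sum.union_disjoint, auto)
    also have "(\<Sum>i = d + 1..d'. ?f i) = (\<Sum>j<k. ?f (d + 1 + j))"
      by (rule sum.reindex_bij_witness[of _ "\<lambda>j. d + 1 + j" "\<lambda>i. i - (d + 1)"]) (auto simp: k_def)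
    also have "\<dots> = poly ?p 0 * (\<Sum>j<k. y j * poly q (lam (d + 1 + j)))"
      unfolding sum_distrib_left by (rule sum.cong[OF refl]) (subst P_node, auto)
    also have "semi_inner lam b d ?P q = - (poly ?p 0 * (\<Sum>j<k. y j * poly q (lam (d + 1 + j))))"
      using pi_poly_props(3)[OF def_d q] U_inner[OF q]
      by (simp add: semi_inner_diff_left semi_inner_smult_left)
    finally show "semi_inner lam b d' ?P q = 0" by simp
  qed
  moreover have "(\<Sum>j = d + 1..d'. Polynomial.smult (\<sigma> $ (j - (d + 1))) (xi_poly lam b d (n - 1) j)) = U y"
    unfolding U_def
    by (rule sum.reindex_bij_witness[of _ "\<lambda>j. d + 1 + j" "\<lambda>i. i - (d + 1)"])
       (auto simp: k_def xi[simplified] y_def \<rho>_def)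
  ultimately show ?thesis using inv(1) by (simp add: M_def)
qed

end
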